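(* Let $((\mathfrak g_0,[\cdot,\cdot]_{\mathfrak g_0},T_0),(\mathfrak g_1,[\cdot,\cdot]_{\mathfrak g_1},T_1),\mathrm d,\rho)$ be a crossed module of Rota-Baxter Lie algebras. Define, for $x,y\in\mathfrak g_0$ and $u,v\in\mathfrak g_1$, $$[x,y]_{T_0}=[T_0x,y]_{\mathfrak g_0}-[T_0y,x]_{\mathfrak g_0},\quad [u,v]_{T_1}=[T_1u,v]_{\mathfrak g_1}-[T_1v,u]_{\mathfrak g_1},\quad \rho_T(x)u=\rho(T_0x)u+\rho(x)T_1(u).$$ Then $((\mathfrak g_0,[\cdot,\cdot]_{T_0}),(\mathfrak g_1,[\cdot,\cdot]_{T_1}),\mathrm d,\rho_T)$ is a crossed module of Lie algebras. Furthermore, the pair $(T_0,T_1)$ is a homomorphism of crossed modules of Lie algebras from $((\mathfrak g_0,[\cdot,\cdot]_{T_0}),(\mathfrak g_1,[\cdot,\cdot]_{T_1}),\mathrm d,\rho_T)$ to $((\mathfrak g_0,[\cdot,\cdot]_{\mathfrak g_0}),(\mathfrak g_1,[\cdot,\cdot]_{\mathfrak g_1}),\mathrm d,\rho)$.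
   Context: All vector spaces are finite dimensional over an algebraically closed field $\mathbb K$ of characteristic $0$. A Rota-Baxter Lie algebra $(\mathfrak g,[\cdot,\cdot]_{\mathfrak g},R)$ is a Lie algebra with a linear map $R:\mathfrak g\to\mathfrak g$ satisfying $[R(x),R(y)]_{\mathfrak g}=R([R(x),y]_{\mathfrak g}+[x,R(y)]_{\mathfrak g})$. A homomorphism $(\mathfrak g,R)\to(\mathfrak h,S)$ is a Lie algebra homomorphism $\phi$ with $\phi\circ R=S\circ\phi$. A crossed module of Lie algebras $((\mathfrak g_0,[\cdot,\cdot]_{\mathfrak g_0}),(\mathfrak g_1,[\cdot,\cdot]_{\mathfrak g_1}),\mathrm d,\rho)$ consists of Lie algebras $\mathfrak g_0,\mathfrak g_1$, a Lie algebra homomorphism $\mathrm d:\mathfrak g_1\to\mathfrak g_0$ and a Lie algebra homomorphism $\rho:\mathfrak g_0\to\mathrm{Der}(\mathfrak g_1)$ such that $\mathrm d(\rho(x)(u))=[x,\mathrm du]_{\mathfrak g_0}$ and $\rho(\mathrm du)(v)=[u,v]_{\mathfrak g_1}$ for all $x\in\mathfrak g_0$, $u,v\in\mathfrak g_1$. A crossed module of Rota-Baxter Lie algebras $((\mathfrak g_0,[\cdot,\cdot]_{\mathfrak g_0},T_0),(\mathfrak g_1,[\cdot,\cdot]_{\mathfrak g_1},T_1),\mathrm d,\rho)$ consists of Rota-Baxter Lie algebras $(\mathfrak g_0,T_0)$, $(\mathfrak g_1,T_1)$, a Rota-Baxter Lie algebra homomorphism $\mathrm d:\mathfrak g_1\to\mathfrak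 g_0$ and an action $(\rho,T_1)$ of $(\mathfrak g_0,T_0)$ on $\mathfrak g_1$ by derivations, i.e. a Lie algebra homomorphism $\rho:\mathfrak g_0\to\mathrm{Der}(\mathfrak g_1)$ with $\rho(T_0(x))\circ T_1=T_1\circ\rho(T_0(x))+T_1\circ\rho(x)\circ T_1$ for all $x\in\mathfrak g_0$, such that $\mathrm d(\rho(x)(u))=[x,\mathrm du]_{\mathfrak g_0}$ and $\rho(\mathrm du)(v)=[u,v]_{\mathfrak g_1}$ for all $x\in\mathfrak g_0$, $u,v\in\mathfrak g_1$. Forgetting $T_0,T_1$ gives a crossed module of Lie algebras. A homomorphism of crossed modules of Lie algebras from $(\mathfrak g_0,\mathfrak g_1,\mathrm d_{\mathfrak g},\rho_{\mathfrak g})$ to $(\mathfrak h_0,\mathfrak h_1,\mathrm d_{\mathfrak h},\rho_{\mathfrak h})$ is a pair $(\psi_0,\psi_1)$ of Lie algebra homomorphisms $\psi_0:\mathfrak g_0\to\mathfrak h_0$, $\psi_1:\mathfrak g_1\to\mathfrak h_1$ with $\mathrm d_{\mathfrak h}\circ\psi_1=\psi_0\circ\mathrm d_{\mathfrak g}$ and $\psi_1(\rho_{\mathfrak g}(x)v)=\rho_{\mathfrak h}(\psi_0(x))\psi_1(v)$ for all $x\in\mathfrak g_0$, $v\in\mathfrak g_1$. *)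

theory Defs
  imports "HOL-Computational_Algebra.Polynomial"
begin

text \<open>
  A vector space is a whole type together with an explicit scalar multiplication, so that two or more
  brackets can live on the same space.  All vector spaces are finite dimensional; this
  convention is built into the notion of a Lie algebra.
\<close>

locale lie_algebra = vector_space scale
  for scale :: "'k::field \<Rightarrow> 'g::ab_group_add \<Rightarrow> 'g" +
  fixes bracket :: "'g \<Rightarrow> 'g \<Rightarrow> 'g"
  assumes finite_dimensional: "\<exists>Basis. finite_dimensional_vector_space scale Basis"
    and bracket_linear_left: "Vector_Spaces.linear scale scale (\<lambda>x. bracket x y)"
    and bracket_linear_right: "Vector_Spaces.linear scale scale (\<lambda>y. bracket x y)"
    and bracket_alternating: "bracket x x = 0"
    and jacobi: "bracket x (bracket y z) + bracket y (bracket z x) + bracket z (bracket x y) = 0"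

locale lie_algebra_hom =
  dom: lie_algebra scaleG bracketG + cod: lie_algebra scaleH bracketH
  for scaleG :: "'k::field \<Rightarrow> 'g::ab_group_add \<Rightarrow> 'g" and bracketG :: "'g \<Rightarrow> 'g \<Rightarrow> 'g"
    and scaleH :: "'k \<Rightarrow> 'h::ab_group_add \<Rightarrow> 'h" and bracketH :: "'h \<Rightarrow> 'h \<Rightarrow> 'h" +
  fixes \<phi> :: "'g \<Rightarrow> 'h"
  assumes hom_linear: "Vector_Spaces.linear scaleG scaleH \<phi>"
    and hom_bracket: "\<phi> (bracketG x y) = bracketH (\<phi> x) (\<phi> y)"

definition Der ::
  "('k::field \<Rightarrow> 'g::ab_group_add \<Rightarrow> 'g) \<Rightarrow> ('g \<Rightarrow> 'g \<Rightarrow> 'g) \<Rightarrow> ('g \<Rightarrow> 'g) set" where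
  "Der scale bracket =
     {D. Vector_Spaces.linear scale scale D \<and>
         (\<forall>u v. D (bracket u v) = bracket (D u) v + bracket u (D v))}"

text \<open>
  A Lie algebra homomorphism from \<open>\<gg>\<^sub>0\<close> to the Lie algebra of derivations of \<open>\<gg>\<^sub>1\<close>.  The vector
  space structure of the latter is pointwise and its bracket is the commutator, so linearity of
  \<open>\<rho>\<close> is linearity of \<open>\<rho> x u\<close> in \<open>x\<close> for every \<open>u\<close>.
\<close>

locale lie_algebra_action =
  g0: lie_algebra scale0 bracket0 + g1: lie_algebra scale1 bracket1
  for scale0 :: "'k::field \<Rightarrow> 'g0::ab_group_add \<Rightarrow> 'g0" and bracket0 :: "'g0 \<Rightarrow> 'g0 \<Rightarrow> 'g0"
    and scale1 :: "'k \<Rightarrow> 'g1::ab_group_add \<Rightarrow> 'g1" and bracket1 :: "'g1 \<Rightarrow> 'g1 \<Rightarrow> 'g1" +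
  fixes \<rho> :: "'g0 \<Rightarrow> 'g1 \<Rightarrow> 'g1"
  assumes action_Der: "\<rho> x \<in> Der scale1 bracket1"
    and action_linear: "Vector_Spaces.linear scale0 scale1 (\<lambda>x. \<rho> x u)"
    and action_bracket: "\<rho> (bracket0 x y) = (\<lambda>u. \<rho> x (\<rho> y u) - \<rho> y (\<rho> x u))"

locale lie_crossed_module =
  lie_algebra_hom scale1 bracket1 scale0 bracket0 d +
  lie_algebra_action scale0 bracket0 scale1 bracket1 \<rho>
  for scale0 :: "'k::field \<Rightarrow> 'g0::ab_group_add \<Rightarrow> 'g0" and bracket0 :: "'g0 \<Rightarrow> 'g0 \<Rightarrow> 'g0"
    and scale1 :: "'k \<Rightarrow> 'g1::ab_group_add \<Rightarrow> 'g1" and bracket1 :: "'g1 \<Rightarrow> 'g1 \<Rightarrow> 'g1"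
    and d :: "'g1 \<Rightarrow> 'g0" and \<rho> :: "'g0 \<Rightarrow> 'g1 \<Rightarrow> 'g1" +
  assumes equivariance: "d (\<rho> x u) = bracket0 x (d u)"
    and peiffer: "\<rho> (d u) v = bracket1 u v"

locale lie_crossed_module_hom =
  dom: lie_crossed_module scaleG0 bracketG0 scaleG1 bracketG1 dG \<rho>G +
  cod: lie_crossed_module scaleH0 bracketH0 scaleH1 bracketH1 dH \<rho>H +
  hom0: lie_algebra_hom scaleG0 bracketG0 scaleH0 bracketH0 \<psi>0 +
  hom1: lie_algebra_hom scaleG1 bracketG1 scaleH1 bracketH1 \<psi>1
  for scaleG0 :: "'k::field \<Rightarrow> 'g0::ab_group_add \<Rightarrow> 'g0" and bracketG0 :: "'g0 \<Rightarrow> 'g0 \<Rightarrow> 'g0"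
    and scaleG1 :: "'k \<Rightarrow> 'g1::ab_group_add \<Rightarrow> 'g1" and bracketG1 :: "'g1 \<Rightarrow> 'g1 \<Rightarrow> 'g1"
    and dG :: "'g1 \<Rightarrow> 'g0" and \<rho>G :: "'g0 \<Rightarrow> 'g1 \<Rightarrow> 'g1"
    and scaleH0 :: "'k \<Rightarrow> 'h0::ab_group_add \<Rightarrow> 'h0" and bracketH0 :: "'h0 \<Rightarrow> 'h0 \<Rightarrow> 'h0"
    and scaleH1 :: "'k \<Rightarrow> 'h1::ab_group_add \<Rightarrow> 'h1" and bracketH1 :: "'h1 \<Rightarrow> 'h1 \<Rightarrow> 'h1"
    and dH :: "'h1 \<Rightarrow> 'h0" and \<rho>H :: "'h0 \<Rightarrow> 'h1 \<Rightarrow> 'h1"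
    and \<psi>0 :: "'g0 \<Rightarrow> 'h0" and \<psi>1 :: "'g1 \<Rightarrow> 'h1" +
  assumes hom_d: "dH \<circ> \<psi>1 = \<psi>0 \<circ> dG"
    and hom_action: "\<psi>1 (\<rho>G x v) = \<rho>H (\<psi>0 x) (\<psi>1 v)"

locale rota_baxter_lie_algebra = lie_algebra scale bracket
  for scale :: "'k::field \<Rightarrow> 'g::ab_group_add \<Rightarrow> 'g" and bracket :: "'g \<Rightarrow> 'g \<Rightarrow> 'g" +
  fixes R :: "'g \<Rightarrow> 'g"
  assumes R_linear: "Vector_Spaces.linear scale scale R"
    and rota_baxter: "bracket (R x) (R y) = R (bracket (R x) y + bracket x (R y))"

locale rota_baxter_lie_algebra_hom =
  dom: rota_baxter_lie_algebra scaleG bracketG R + cod: rota_baxter_lie_algebra scaleH bracketH S +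
  lie_algebra_hom scaleG bracketG scaleH bracketH \<phi>
  for scaleG :: "'k::field \<Rightarrow> 'g::ab_group_add \<Rightarrow> 'g" and bracketG :: "'g \<Rightarrow> 'g \<Rightarrow> 'g"
    and R :: "'g \<Rightarrow> 'g"
    and scaleH :: "'k \<Rightarrow> 'h::ab_group_add \<Rightarrow> 'h" and bracketH :: "'h \<Rightarrow> 'h \<Rightarrow> 'h"
    and S :: "'h \<Rightarrow> 'h"
    and \<phi> :: "'g \<Rightarrow> 'h" +
  assumes hom_rota_baxter: "\<phi> \<circ> R = S \<circ> \<phi>"

locale rota_baxter_action =
  g0: rota_baxter_lie_algebra scale0 bracket0 T0 +
  lie_algebra_action scale0 bracket0 scale1 bracket1 \<rho>
  for scale0 :: "'k::field \<Rightarrow> 'g0::ab_group_add \<Rightarrow> 'g0" and bracket0 :: "'g0 \<Rightarrow> 'g0 \<Rightarrow> 'g0"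
    and T0 :: "'g0 \<Rightarrow> 'g0"
    and scale1 :: "'k \<Rightarrow> 'g1::ab_group_add \<Rightarrow> 'g1" and bracket1 :: "'g1 \<Rightarrow> 'g1 \<Rightarrow> 'g1"
    and \<rho> :: "'g0 \<Rightarrow> 'g1 \<Rightarrow> 'g1" and T1 :: "'g1 \<Rightarrow> 'g1" +
  assumes T1_linear: "Vector_Spaces.linear scale1 scale1 T1"
    and rota_baxter_action:
      "\<rho> (T0 x) \<circ> T1 = (\<lambda>u. (T1 \<circ> \<rho> (T0 x)) u + (T1 \<circ> \<rho> x \<circ> T1) u)"

locale rota_baxter_crossed_module =
  rota_baxter_lie_algebra_hom scale1 bracket1 T1 scale0 bracket0 T0 d +
  rota_baxter_action scale0 bracket0 T0 scale1 bracket1 \<rho> T1 +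
  lie_crossed_module scale0 bracket0 scale1 bracket1 d \<rho>
  for scale0 :: "'k::field \<Rightarrow> 'g0::ab_group_add \<Rightarrow> 'g0" and bracket0 :: "'g0 \<Rightarrow> 'g0 \<Rightarrow> 'g0"
    and T0 :: "'g0 \<Rightarrow> 'g0"
    and scale1 :: "'k \<Rightarrow> 'g1::ab_group_add \<Rightarrow> 'g1" and bracket1 :: "'g1 \<Rightarrow> 'g1 \<Rightarrow> 'g1"
    and T1 :: "'g1 \<Rightarrow> 'g1"
    and d :: "'g1 \<Rightarrow> 'g0" and \<rho> :: "'g0 \<Rightarrow> 'g1 \<Rightarrow> 'g1"

definition descendent_bracket ::
  "('g::ab_group_add \<Rightarrow> 'g \<Rightarrow> 'g) \<Rightarrow> ('g \<Rightarrow> 'g) \<Rightarrow> 'g \<Rightarrow> 'g \<Rightarrow> 'g" where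
  "descendent_bracket bracket T x y = bracket (T x) y - bracket (T y) x"

definition descendent_action ::
  "('g0 \<Rightarrow> 'g1::ab_group_add \<Rightarrow> 'g1) \<Rightarrow> ('g0 \<Rightarrow> 'g0) \<Rightarrow> ('g1 \<Rightarrow> 'g1) \<Rightarrow> 'g0 \<Rightarrow> 'g1 \<Rightarrow> 'g1" where
  "descendent_action \<rho> T0 T1 x u = \<rho> (T0 x) u + \<rho> x (T1 u)"

end

theory Submission
  imports Defs
begin

text \<open>
  The Rota-Baxter identities say precisely that \<open>T\<^sub>0\<close> and \<open>T\<^sub>1\<close> turn the new operations into
  the old ones: \<open>T[x, y]\<^sub>T = [Tx, Ty]\<close> and \<open>T\<^sub>1(\<rho>\<^sub>T(x)u) = \<rho>(T\<^sub>0x)(T\<^sub>1u)\<close>.  Every axiom for the new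
  structure then becomes a sum of instances of the same axiom for the old one; for example,
  \<open>[x, [y, z]\<^sub>T]\<^sub>T = [Tx, [Ty, z]] + [Tx, [y, Tz]] + [x, [Ty, Tz]]\<close>, so that the Jacobiator of
  \<open>(x, y, z)\<close> is the sum of those of \<open>(Tx, Ty, z)\<close>, \<open>(Tx, y, Tz)\<close> and \<open>(x, Ty, Tz)\<close>.
\<close>

context lie_algebra
begin

lemma bracket_add_left: "bracket (x + y) z = bracket x z + bracket y z"
  using bracket_linear_left by (simp add: Vector_Spaces.linear_iff)

lemma bracket_add_right: "bracket x (y + z) = bracket x y + bracket x z"
  using bracket_linear_right by (simp add: Vector_Spaces.linear_iff)

lemma bracket_scale_left: "bracket (scale c x) y = scale c (bracket x y)"
  using bracket_linear_left by (simp add: Vector_Spaces.linear_iff)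

lemma bracket_scale_right: "bracket x (scale c y) = scale c (bracket x y)"
  using bracket_linear_right by (simp add: Vector_Spaces.linear_iff)

lemma bracket_antisym: "bracket y x = - bracket x y"
proof -
  have "bracket x x + bracket y x + (bracket x y + bracket y y) = 0"
    using bracket_alternating[of "x + y"] by (simp only: bracket_add_left bracket_add_right)
  then show ?thesis
    by (simp add: bracket_alternating eq_neg_iff_add_eq_0)
qed

text \<open>Antisymmetry brings the new bracket into the form that stands under the operator in the
  Rota-Baxter identity. This symmetric form is also the one in which bilinearity can be read
  off.\<close>

lemma descendent_bracket_eq:
  "descendent_bracket bracket T x y = bracket (T x) y + bracket x (T y)"
  by (simp add: descendent_bracket_def bracket_antisym[of "T y" x])

end

context rota_baxter_lie_algebra
begin

lemma R_add: "R (x + y) = R x + R y"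
  using R_linear by (simp add: Vector_Spaces.linear_iff)

lemma R_scale: "R (scale c x) = scale c (R x)"
  using R_linear by (simp add: Vector_Spaces.linear_iff)

lemma R_descendent_bracket: "R (descendent_bracket bracket R x y) = bracket (R x) (R y)"
  by (simp add: descendent_bracket_eq rota_baxter)

lemma descendent_bracket_twice:
  "descendent_bracket bracket R x (descendent_bracket bracket R y z) =
    bracket (R x) (bracket (R y) z) + bracket (R x) (bracket y (R z)) + bracket x (bracket (R y) (R z))"
  \<comment> \<open>Only the outer bracket is unfolded at first: the inner one must stay folded
    under \<open>R\<close> until \<open>R_descendent_bracket\<close> has absorbed that
    \<open>R\<close>.\<close>
  by (simp add: descendent_bracket_eq[of R x] R_descendent_bracket)
    (simp add: descendent_bracket_eq bracket_add_right)

lemma lie_algebra_descendent: "lie_algebra scale (descendent_bracket bracket R)"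
proof (intro lie_algebra.intro lie_algebra_axioms.intro)
  show "vector_space scale"
    by (rule vector_space_axioms)
  show "\<exists>Basis. finite_dimensional_vector_space scale Basis"
    by (rule finite_dimensional)
  show "Vector_Spaces.linear scale scale (\<lambda>x. descendent_bracket bracket R x y)" for y
    by (simp add: Vector_Spaces.linear_iff vector_space_axioms descendent_bracket_eq R_add R_scale
        bracket_add_left bracket_scale_left scale_right_distrib)
  show "Vector_Spaces.linear scale scale (\<lambda>y. descendent_bracket bracket R x y)" for x
    by (simp add: Vector_Spaces.linear_iff vector_space_axioms descendent_bracket_eq R_add R_scale
        bracket_add_right bracket_scale_right scale_right_distrib)
  show "descendent_bracket bracket R x x = 0" for x
    by (simp add: descendent_bracket_def)
  show "descendent_bracket bracket R x (descendent_bracket bracket R y z) +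
      descendent_bracket bracket R y (descendent_bracket bracket R z x) +
      descendent_bracket bracket R z (descendent_bracket bracket R x y) = 0" (is "?J = 0") for x y z
  proof -
    have "?J =
        (bracket (R x) (bracket (R y) z) + bracket (R y) (bracket z (R x)) + bracket z (bracket (R x) (R y))) +
        (bracket (R x) (bracket y (R z)) + bracket y (bracket (R z) (R x)) + bracket (R z) (bracket (R x) y)) +
        (bracket x (bracket (R y) (R z)) + bracket (R y) (bracket (R z) x) + bracket (R z) (bracket x (R y)))"
      unfolding descendent_bracket_twice by (simp add: ac_simps)
    then show ?thesis
      by (simp add: jacobi)
  qed
qed

lemma lie_algebra_hom_descendent:
  "lie_algebra_hom scale (descendent_bracket bracket R) scale bracket R"
  by (intro lie_algebra_hom.intro lie_algebra_hom_axioms.intro lie_algebra_descendent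
      lie_algebra_axioms R_linear R_descendent_bracket)

end

context rota_baxter_lie_algebra_hom
begin

lemma hom_R: "\<phi> (R x) = S (\<phi> x)"
  using fun_cong[OF hom_rota_baxter, of x] by simp

text \<open>As \<phi> intertwines \<open>R\<close> and \<open>S\<close>, it carries the two terms of
  the new bracket on its domain to the corresponding terms on its codomain. For a crossed module,
  \<phi> is \<open>d\<close>.\<close>

lemma hom_descendent_bracket:
  "\<phi> (descendent_bracket bracketG R x y) = descendent_bracket bracketH S (\<phi> x) (\<phi> y)"
  using hom_linear
  by (simp add: Vector_Spaces.linear_iff dom.descendent_bracket_eq cod.descendent_bracket_eq
      hom_bracket hom_R)

lemma descendent_lie_algebra_hom:
  "lie_algebra_hom scaleG (descendent_bracket bracketG R) scaleH (descendent_bracket bracketH S) \<phi>"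
  by (intro lie_algebra_hom.intro lie_algebra_hom_axioms.intro dom.lie_algebra_descendent
      cod.lie_algebra_descendent hom_linear hom_descendent_bracket)

end

context lie_algebra_action
begin

lemma action_add_right: "\<rho> x (u + v) = \<rho> x u + \<rho> x v"
  using action_Der[of x] by (simp add: Der_def Vector_Spaces.linear_iff)

lemma action_scale_right: "\<rho> x (scale1 c u) = scale1 c (\<rho> x u)"
  using action_Der[of x] by (simp add: Der_def Vector_Spaces.linear_iff)

lemma action_derivation: "\<rho> x (bracket1 u v) = bracket1 (\<rho> x u) v + bracket1 u (\<rho> x v)"
  using action_Der[of x] by (simp add: Der_def)

lemma action_add_left: "\<rho> (x + y) u = \<rho> x u + \<rho> y u"
  using action_linear by (simp add: Vector_Spaces.linear_iff)

lemma action_scale_left: "\<rho> (scale0 c x) u = scale1 c (\<rho> x u)"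
  using action_linear by (simp add: Vector_Spaces.linear_iff)

end

context rota_baxter_action
begin

lemma T1_add: "T1 (u + v) = T1 u + T1 v"
  using T1_linear by (simp add: Vector_Spaces.linear_iff)

lemma T1_scale: "T1 (scale1 c u) = scale1 c (T1 u)"
  using T1_linear by (simp add: Vector_Spaces.linear_iff)

lemma T1_descendent_action: "T1 (descendent_action \<rho> T0 T1 x u) = \<rho> (T0 x) (T1 u)"
  using fun_cong[OF rota_baxter_action, of x u] by (simp add: descendent_action_def T1_add)

text \<open>The outer action applies \<open>T1\<close> to the inner one, and
  \<open>T1_descendent_action\<close> absorbs it. In each resulting term exactly two of
  \<open>x\<close>, \<open>y\<close>, \<open>u\<close> carry an operator.\<close>

lemma descendent_action_twice:
  "descendent_action \<rho> T0 T1 x (descendent_action \<rho> T0 T1 y u) =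
    \<rho> (T0 x) (\<rho> (T0 y) u) + \<rho> (T0 x) (\<rho> y (T1 u)) + \<rho> x (\<rho> (T0 y) (T1 u))"
  by (simp add: descendent_action_def[of \<rho> T0 T1 x] T1_descendent_action)
    (simp add: descendent_action_def action_add_right)

text \<open>The locale provides only linearity of \<open>T1\<close> and its compatibility with
  \<rho>. The hypothesis adds the Rota-Baxter identity on \<open>bracket1\<close>, which rewrites
  \<open>T1\<close> of the new bracket as \<open>bracket1 (T1 u) (T1 v)\<close>.\<close>

lemma descendent_action_derivation:
  assumes "rota_baxter_lie_algebra scale1 bracket1 T1"
  shows "descendent_action \<rho> T0 T1 x (descendent_bracket bracket1 T1 u v) =
    descendent_bracket bracket1 T1 (descendent_action \<rho> T0 T1 x u) v +
    descendent_bracket bracket1 T1 u (descendent_action \<rho> T0 T1 x v)"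
proof -
  interpret rb1: rota_baxter_lie_algebra scale1 bracket1 T1
    by (rule assms)
  have "descendent_action \<rho> T0 T1 x (descendent_bracket bracket1 T1 u v) =
      \<rho> (T0 x) (bracket1 (T1 u) v + bracket1 u (T1 v)) + \<rho> x (bracket1 (T1 u) (T1 v))"
    by (simp only: descendent_action_def rb1.R_descendent_bracket) (simp only: g1.descendent_bracket_eq)
  \<comment> \<open>The Leibniz rule for three old brackets gives six terms. They are grouped so
    that the first row is the new bracket of the transformed \<open>u\<close> with \<open>v\<close>,
    and the second that of \<open>u\<close> with the transformed \<open>v\<close>.\<close>
  also have "\<dots> =
      bracket1 (\<rho> (T0 x) (T1 u)) v + bracket1 (\<rho> (T0 x) u + \<rho> x (T1 u)) (T1 v) +
      (bracket1 (T1 u) (\<rho> (T0 x) v + \<rho> x (T1 v)) + bracket1 u (\<rho> (T0 x) (T1 v)))"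
    by (simp add: action_add_right action_derivation g1.bracket_add_left g1.bracket_add_right ac_simps)
  finally show ?thesis
    by (simp add: g1.descendent_bracket_eq T1_descendent_action) (simp add: descendent_action_def)
qed

lemma lie_algebra_action_descendent:
  assumes "rota_baxter_lie_algebra scale1 bracket1 T1"
  shows "lie_algebra_action scale0 (descendent_bracket bracket0 T0)
    scale1 (descendent_bracket bracket1 T1) (descendent_action \<rho> T0 T1)"
proof (intro lie_algebra_action.intro lie_algebra_action_axioms.intro)
  show "lie_algebra scale0 (descendent_bracket bracket0 T0)"
    by (rule g0.lie_algebra_descendent)
  show "lie_algebra scale1 (descendent_bracket bracket1 T1)"
    by (rule rota_baxter_lie_algebra.lie_algebra_descendent[OF assms])
  show "descendent_action \<rho> T0 T1 x \<in> Der scale1 (descendent_bracket bracket1 T1)" for x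
  proof -
    have "Vector_Spaces.linear scale1 scale1 (descendent_action \<rho> T0 T1 x)"
      by (simp add: Vector_Spaces.linear_iff g1.vector_space_axioms descendent_action_def T1_add T1_scale
          action_add_right action_scale_right g1.scale_right_distrib)
    then show ?thesis
      using descendent_action_derivation[OF assms] by (simp add: Der_def)
  qed
  show "Vector_Spaces.linear scale0 scale1 (\<lambda>x. descendent_action \<rho> T0 T1 x u)" for u
    by (simp add: Vector_Spaces.linear_iff g0.vector_space_axioms g1.vector_space_axioms
        descendent_action_def g0.R_add g0.R_scale action_add_left action_scale_left
        g1.scale_right_distrib)
  show "descendent_action \<rho> T0 T1 (descendent_bracket bracket0 T0 x y) =
      (\<lambda>u. descendent_action \<rho> T0 T1 x (descendent_action \<rho> T0 T1 y u) -
           descendent_action \<rho> T0 T1 y (descendent_action \<rho> T0 T1 x u))" for x y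
  proof
    fix u
    \<comment> \<open>Three old brackets appear: \<open>action_bracket\<close> is then applied to
      the pair \<open>T0 x\<close>, \<open>T0 y\<close> acting on \<open>u\<close>, and to the pairs
      \<open>T0 x\<close>, \<open>y\<close> and \<open>x\<close>, \<open>T0 y\<close> acting on
      \<open>T1 u\<close>. The three commutators add up to the new one.\<close>
    have "descendent_action \<rho> T0 T1 (descendent_bracket bracket0 T0 x y) u =
        \<rho> (bracket0 (T0 x) (T0 y)) u + \<rho> (bracket0 (T0 x) y + bracket0 x (T0 y)) (T1 u)"
      by (simp only: descendent_action_def g0.R_descendent_bracket) (simp only: g0.descendent_bracket_eq)
    then show "descendent_action \<rho> T0 T1 (descendent_bracket bracket0 T0 x y) u =
        descendent_action \<rho> T0 T1 x (descendent_action \<rho> T0 T1 y u) -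
        descendent_action \<rho> T0 T1 y (descendent_action \<rho> T0 T1 x u)"
      by (simp add: descendent_action_twice action_add_left action_bracket algebra_simps)
  qed
qed

end

context rota_baxter_crossed_module
begin

lemma lie_crossed_module_descendent:
  "lie_crossed_module scale0 (descendent_bracket bracket0 T0) scale1 (descendent_bracket bracket1 T1)
    d (descendent_action \<rho> T0 T1)"
proof (intro lie_crossed_module.intro lie_crossed_module_axioms.intro)
  show "lie_algebra_hom scale1 (descendent_bracket bracket1 T1) scale0 (descendent_bracket bracket0 T0) d"
    by (rule descendent_lie_algebra_hom)
  show "lie_algebra_action scale0 (descendent_bracket bracket0 T0)
      scale1 (descendent_bracket bracket1 T1) (descendent_action \<rho> T0 T1)"
    by (rule lie_algebra_action_descendent[OF dom.rota_baxter_lie_algebra_axioms])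
  \<comment> \<open>Equivariance applied to each summand gives
    \<open>bracket0 (T0 x) (d u) + bracket0 x (d (T1 u))\<close>, where \<open>d (T1 u)\<close>
    equals \<open>T0 (d u)\<close>.\<close>
  show "d (descendent_action \<rho> T0 T1 x u) = descendent_bracket bracket0 T0 x (d u)" for x u
    using hom_linear
    by (simp add: Vector_Spaces.linear_iff descendent_action_def cod.descendent_bracket_eq
        equivariance hom_R)
  show "descendent_action \<rho> T0 T1 (d u) v = descendent_bracket bracket1 T1 u v" for u v
    \<comment> \<open>Here \<open>hom_R\<close> is used from right to left: it turns
      \<open>T0 (d u)\<close> into \<open>d (T1 u)\<close>, to which \<open>peiffer\<close>
      applies.\<close>
    by (simp add: descendent_action_def dom.descendent_bracket_eq peiffer flip: hom_R)
qed

text \<open>The prefixes \<open>dom\<close> and \<open>cod\<close> refer to \<open>d\<close>, so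
  they supply the facts on \<open>T1\<close> and on \<open>T0\<close> respectively. Compatibility of
  the pair with \<open>d\<close> is the assumption that \<open>d\<close> is a Rota-Baxter
  homomorphism, and compatibility with the actions is \<open>T1_descendent_action\<close>.\<close>

lemma lie_crossed_module_hom_descendent:
  "lie_crossed_module_hom
    scale0 (descendent_bracket bracket0 T0) scale1 (descendent_bracket bracket1 T1)
    d (descendent_action \<rho> T0 T1) scale0 bracket0 scale1 bracket1 d \<rho> T0 T1"
  by (intro lie_crossed_module_hom.intro lie_crossed_module_hom_axioms.intro
      lie_crossed_module_descendent lie_crossed_module_axioms cod.lie_algebra_hom_descendent
      dom.lie_algebra_hom_descendent hom_rota_baxter T1_descendent_action)

end

theorem proposition4p10:
  fixes scale0 :: "'k::{alg_closed_field, field_char_0} \<Rightarrow> 'g0::ab_group_add \<Rightarrow> 'g0"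
    and bracket0 :: "'g0 \<Rightarrow> 'g0 \<Rightarrow> 'g0" and T0 :: "'g0 \<Rightarrow> 'g0"
    and scale1 :: "'k \<Rightarrow> 'g1::ab_group_add \<Rightarrow> 'g1"
    and bracket1 :: "'g1 \<Rightarrow> 'g1 \<Rightarrow> 'g1" and T1 :: "'g1 \<Rightarrow> 'g1"
    and d :: "'g1 \<Rightarrow> 'g0" and \<rho> :: "'g0 \<Rightarrow> 'g1 \<Rightarrow> 'g1"
  assumes "rota_baxter_crossed_module scale0 bracket0 T0 scale1 bracket1 T1 d \<rho>"
  shows "lie_crossed_module
           scale0 (descendent_bracket bracket0 T0) scale1 (descendent_bracket bracket1 T1)
           d (descendent_action \<rho> T0 T1) \<and>
         lie_crossed_module_hom
           scale0 (descendent_bracket bracket0 T0) scale1 (descendent_bracket bracket1 T1)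
           d (descendent_action \<rho> T0 T1)
           scale0 bracket0 scale1 bracket1 d \<rho>
           T0 T1"
  using rota_baxter_crossed_module.lie_crossed_module_descendent[OF assms]
    rota_baxter_crossed_module.lie_crossed_module_hom_descendent[OF assms] ..

end
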